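(* Assume that for each $i$, $J_i$ is continuously differentiable and convex in $x_i$ for given $x_{-i}$, that $\mathcal X$ satisfies Slater's condition, that $G$ has full row rank, and that the communication graph $\mathcal G$ is undirected and connected. Let $\alpha>0$ and let $(\bar x,\bar z)$ be an equilibrium of the dynamics $$\dot x=-F(x)-G_d^\top\lambda,\qquad \dot z=L\lambda,$$ $$\lambda=\Lambda(x,z):=\operatorname*{arg\,min}_{\lambda\ge 0}\ \tfrac12\|G_d^\top\lambda\|^2+\lambda^\top\big[G_dF(x)-\alpha(G_dx-H_s)+Lz\big]+\tfrac12\lambda^\top L\lambda .$$ Then $\bar x$ together with the corresponding dual variable $\bar\lambda=\Lambda(\bar x,\bar z)$ solves the KKT conditions $$F(\bar x)+G_d^\top\bar\lambda=0,\quad \bar\lambda^\top[\mathbf 1_N\otimes(G\bar x-H)]=0,\quad G\bar x-H\le0,\quad \bar\lambda\ge0,$$ and $\bar\lambda=\mathbf 1_N\otimes\underline\lambda$ for some $\underline\lambda\in\mathbb R^m_+$. Hence $\bar x$ is a v-GNE of the game.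
   Context: Game. There are $N$ players indexed by $\mathcal I=\{1,\dots,N\}$. Player $i$ chooses $x_i\in\mathbb R^{n_i}$; $n=\sum_i n_i$; $x=\mathrm{col}\{x_i\}_{i\in\mathcal I}\in\mathbb R^n$ is the stacked vector and $x_{-i}$ the stacked vector of the decisions of all players other than $i$. Player $i$ has objective $J_i(x_i,x_{-i})$ and local constraint data $g_i\in\mathbb R^{m\times n_i}$, $h_i\in\mathbb R^m$. Put $G=[g_1\ \cdots\ g_N]$, $H=\sum_i h_i$, $\mathcal X=\{x\in\mathbb R^n\mid Gx-H\le 0\}$, $G_d=\mathrm{diag}\{g_i\}_{i\in\mathcal I}$ (block diagonal), $H_s=\mathrm{col}\{h_i\}_{i\in\mathcal I}$, and $F(x)=\mathrm{col}\{\nabla_{x_i}J_i(x_i,x_{-i})\}_{i\in\mathcal I}$. Inequalities between vectors are entrywise. The game is: for each $i$, $\min_{x_i} J_i(x_i,x_{-i})$ subject to $(x_i,x_{-i})\in\mathcal X$. A GNE is $x^*$ such that, for all $i$, $x_i^*$ minimizes $J_i(x_i,x_{-i}^* )$ over $x_i$ with $(x_i,x_{-i}^* )\in\mathcal X$. A v-GNE (variational GNE) is a GNE that solves VI$(\mathcal X,F)$, i.e. $x^*\in\mathcal X$ and $(x-x^* )^\top F(x^* )\ge0$ for all $x\in\mathcal X$; equivalently, the KKT conditions hold with all players' multipliers $\lambda_i^*\in\mathbb R^m_+$ identical. Communication graph: $\mathcal G$ is an undirected weighted graph on $\mathcal I$ with symmetric adjacency matrix $\mathcal A=[a_{ij}]$,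 $a_{ij}\ge0$, $a_{ii}=0$, $a_{ij}>0$ iff $(i,j)$ is an edge; Laplacian $\mathcal L=\mathrm{diag}\{\mathcal A\mathbf 1_N\}-\mathcal A$; $L=\mathcal L\otimes I_m$. The variables $z=\mathrm{col}\{z_i\}$, $\lambda=\mathrm{col}\{\lambda_i\}$ have $z_i,\lambda_i\in\mathbb R^m$. $\mathbf 1_N$ is the all-ones vector. *)

theory Defs
  imports "HOL-Analysis.Analysis"
begin

(* Encoding of the game.  'p is the type of players, 'm the index type of the
   constraints, and 'n the index type of the n = sum_i n_i coordinates of the
   stacked decision vector x.  The map own :: 'n => 'p says which player a
   coordinate belongs to, so x_i consists of the x $ k with own k = i and
   n_i = card {k. own k = i}; the dimensions n_i are thus arbitrary and may differ.
   The stacked matrix G = [g_1 ... g_N] carries the same data as the family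
   (g_i): g_i consists of the columns k of G with own k = i.
   Vectors stacked over players, such as z and lambda in R^(N m), are indexed by
   'p \<times> 'm.  On real ^ 'a the library order \<le> is entrywise, but < is not. *)

(* (y_i, x_{-i}): the coordinates of player i come from y, the others from x. *)
definition replace_block :: "('n::finite \<Rightarrow> 'p) \<Rightarrow> 'p \<Rightarrow> real ^ 'n \<Rightarrow> real ^ 'n \<Rightarrow> real ^ 'n" where
  "replace_block own i y x = (\<chi> k. if own k = i then y $ k else x $ k)"

definition gradient :: "('a::real_inner \<Rightarrow> real) \<Rightarrow> 'a \<Rightarrow> 'a" where
  "gradient f x = (THE D. GDERIV f x :> D)"

definition cont_differentiable :: "('a::real_inner \<Rightarrow> real) \<Rightarrow> bool" where
  "cont_differentiable f \<longleftrightarrow>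
     (\<exists>D. (\<forall>x. GDERIV f x :> D x) \<and> continuous_on UNIV D)"

(* J_i as a function of player i's own decision, the others being fixed as in x.
   It depends on y only through the block of player i; hence convexity and
   continuous differentiability in y are those in x_i, and the entries of its
   gradient in block i form the partial gradient with respect to x_i (the other
   entries vanish). *)
definition own_objective ::
    "('n::finite \<Rightarrow> 'p) \<Rightarrow> ('p \<Rightarrow> real ^ 'n \<Rightarrow> real) \<Rightarrow> 'p \<Rightarrow> real ^ 'n \<Rightarrow> real ^ 'n \<Rightarrow> real" where
  "own_objective own J i x = (\<lambda>y. J i (replace_block own i y x))"

definition pseudo_gradient ::
    "('n::finite \<Rightarrow> 'p) \<Rightarrow> ('p \<Rightarrow> real ^ 'n \<Rightarrow> real) \<Rightarrow> real ^ 'n \<Rightarrow> real ^ 'n" where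
  "pseudo_gradient own J x = (\<chi> k. gradient (own_objective own J (own k) x) x $ k)"

definition feasible_set :: "real ^ 'n::finite ^ 'm::finite \<Rightarrow> ('p::finite \<Rightarrow> real ^ 'm) \<Rightarrow> (real ^ 'n) set" where
  "feasible_set G h = {x. G *v x - (\<Sum>i\<in>UNIV. h i) \<le> 0}"

definition slater :: "real ^ 'n::finite ^ 'm::finite \<Rightarrow> ('p::finite \<Rightarrow> real ^ 'm) \<Rightarrow> bool" where
  "slater G h \<longleftrightarrow> (\<exists>x. \<forall>j. (G *v x - (\<Sum>i\<in>UNIV. h i)) $ j < 0)"

definition is_GNE ::
    "('n::finite \<Rightarrow> 'p) \<Rightarrow> ('p \<Rightarrow> real ^ 'n \<Rightarrow> real) \<Rightarrow> (real ^ 'n) set \<Rightarrow> real ^ 'n \<Rightarrow> bool" where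
  "is_GNE own J X x \<longleftrightarrow>
     (\<forall>i. is_arg_min (own_objective own J i x) (\<lambda>y. replace_block own i y x \<in> X) x)"

definition solves_VI :: "'a::real_inner set \<Rightarrow> ('a \<Rightarrow> 'a) \<Rightarrow> 'a \<Rightarrow> bool" where
  "solves_VI X F x \<longleftrightarrow> x \<in> X \<and> (\<forall>y\<in>X. (y - x) \<bullet> F x \<ge> 0)"

definition is_vGNE ::
    "('n::finite \<Rightarrow> 'p) \<Rightarrow> ('p \<Rightarrow> real ^ 'n \<Rightarrow> real) \<Rightarrow> (real ^ 'n) set \<Rightarrow> real ^ 'n \<Rightarrow> bool" where
  "is_vGNE own J X x \<longleftrightarrow> is_GNE own J X x \<and> solves_VI X (pseudo_gradient own J) x"

definition is_adjacency :: "real ^ 'p::finite ^ 'p \<Rightarrow> bool" where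
  "is_adjacency A \<longleftrightarrow> transpose A = A \<and> (\<forall>i j. 0 \<le> A $ i $ j) \<and> (\<forall>i. A $ i $ i = 0)"

definition graph_edges :: "real ^ 'p::finite ^ 'p \<Rightarrow> ('p \<times> 'p) set" where
  "graph_edges A = {(i, j). A $ i $ j > 0}"

definition graph_connected :: "real ^ 'p::finite ^ 'p \<Rightarrow> bool" where
  "graph_connected A \<longleftrightarrow> (\<forall>i j. (i, j) \<in> (graph_edges A)\<^sup>*)"

(* The numeral 1 :: real ^ 'p is the all-ones vector. *)
definition laplacian :: "real ^ 'p::finite ^ 'p \<Rightarrow> real ^ 'p ^ 'p" where
  "laplacian A = (\<chi> i j. if i = j then (A *v 1) $ i else 0) - A"

definition kron_mat ::
    "real ^ 'b::finite ^ 'a::finite \<Rightarrow> real ^ 'd::finite ^ 'c::finite \<Rightarrow> real ^ ('b \<times> 'd) ^ ('a \<times> 'c)" where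
  "kron_mat A B = (\<chi> r s. A $ fst r $ fst s * B $ snd r $ snd s)"

definition kron_vec :: "real ^ 'a::finite \<Rightarrow> real ^ 'c::finite \<Rightarrow> real ^ ('a \<times> 'c)" where
  "kron_vec a b = (\<chi> r. a $ fst r * b $ snd r)"

definition laplacian_kron :: "real ^ 'p::finite ^ 'p \<Rightarrow> real ^ ('p \<times> 'm::finite) ^ ('p \<times> 'm)" where
  "laplacian_kron A = kron_mat (laplacian A) (mat 1)"

(* G_d = diag{g_i} *)
definition block_diag ::
    "('n::finite \<Rightarrow> 'p::finite) \<Rightarrow> real ^ 'n ^ 'm::finite \<Rightarrow> real ^ 'n ^ ('p \<times> 'm)" where
  "block_diag own G = (\<chi> r k. if own k = fst r then G $ snd r $ k else 0)"

(* H_s = col{h_i} *)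
definition stack :: "('p::finite \<Rightarrow> real ^ 'm::finite) \<Rightarrow> real ^ ('p \<times> 'm)" where
  "stack h = (\<chi> r. h (fst r) $ snd r)"

definition dual_objective ::
    "('n::finite \<Rightarrow> 'p::finite) \<Rightarrow> ('p \<Rightarrow> real ^ 'n \<Rightarrow> real) \<Rightarrow> real ^ 'n ^ 'm::finite \<Rightarrow> ('p \<Rightarrow> real ^ 'm) \<Rightarrow>
     real ^ 'p ^ 'p \<Rightarrow> real \<Rightarrow> real ^ 'n \<Rightarrow> real ^ ('p \<times> 'm) \<Rightarrow> real ^ ('p \<times> 'm) \<Rightarrow> real" where
  "dual_objective own J G h A \<alpha> x z l =
     1/2 * (norm (transpose (block_diag own G) *v l))\<^sup>2
     + l \<bullet> (block_diag own G *v pseudo_gradient own J x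
            - \<alpha> *\<^sub>R (block_diag own G *v x - stack h)
            + laplacian_kron A *v z)
     + 1/2 * (l \<bullet> (laplacian_kron A *v l))"

definition dual_map ::
    "('n::finite \<Rightarrow> 'p::finite) \<Rightarrow> ('p \<Rightarrow> real ^ 'n \<Rightarrow> real) \<Rightarrow> real ^ 'n ^ 'm::finite \<Rightarrow> ('p \<Rightarrow> real ^ 'm) \<Rightarrow>
     real ^ 'p ^ 'p \<Rightarrow> real \<Rightarrow> real ^ 'n \<Rightarrow> real ^ ('p \<times> 'm) \<Rightarrow> real ^ ('p \<times> 'm)" where
  "dual_map own J G h A \<alpha> x z = arg_min (dual_objective own J G h A \<alpha> x z) (\<lambda>l. 0 \<le> l)"

(* Right-hand side of the autonomous system for the state (x, z). *)
definition dynamics ::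
    "('n::finite \<Rightarrow> 'p::finite) \<Rightarrow> ('p \<Rightarrow> real ^ 'n \<Rightarrow> real) \<Rightarrow> real ^ 'n ^ 'm::finite \<Rightarrow> ('p \<Rightarrow> real ^ 'm) \<Rightarrow>
     real ^ 'p ^ 'p \<Rightarrow> real \<Rightarrow> (real ^ 'n) \<times> (real ^ ('p \<times> 'm)) \<Rightarrow> (real ^ 'n) \<times> (real ^ ('p \<times> 'm))" where
  "dynamics own J G h A \<alpha> = (\<lambda>(x, z).
     let l = dual_map own J G h A \<alpha> x z
     in (- pseudo_gradient own J x - transpose (block_diag own G) *v l, laplacian_kron A *v l))"

definition is_equilibrium :: "('s::zero \<Rightarrow> 's) \<Rightarrow> 's \<Rightarrow> bool" where
  "is_equilibrium f s \<longleftrightarrow> f s = 0"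

end

theory Submission
  imports Defs
begin

text \<open>
  The Hessian \<open>G\<^sub>d G\<^sub>d\<^sup>T + L\<close> of the dual objective is positive definite: a vector
  annihilated by \<open>L\<close> is of the form \<open>1 \<otimes> l\<close> because the graph is connected, and then
  \<open>G\<^sub>d\<^sup>T (1 \<otimes> l) = G\<^sup>T l\<close>, which vanishes only for \<open>l = 0\<close> by the rank assumption.
  Hence the argmin defining \<open>\<lambda>\<close> is attained, and it satisfies the complementarity conditions
  \<open>0 \<le> \<lambda>\<close>, \<open>0 \<le> g\<close>, \<open>\<lambda> \<bullet> g = 0\<close> with \<open>g\<close> the gradient of the dual objective.
  At an equilibrium \<open>g\<close> reduces to \<open>L z - \<alpha> (G\<^sub>d x - H\<^sub>s)\<close> and \<open>\<lambda> = 1 \<otimes> l\<close>.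
  Pairing \<open>g\<close> with consensus vectors \<open>1 \<otimes> w\<close> removes \<open>L z\<close> and leaves
  \<open>- \<alpha> (w \<bullet> (G x - H))\<close>, which turns complementarity into the KKT conditions.
\<close>

section \<open>Gradients, convexity, and the step from the variational inequality to a GNE\<close>

lemma gradient_eq: "gradient f x = D" if "GDERIV f x :> D"
  unfolding gradient_def
proof (rule the_equality[where P="\<lambda>D. GDERIV f x :> D", OF that])
  fix E assume E: "GDERIV f x :> E"
  have "(\<lambda>v. v \<bullet> E) = (\<lambda>v. v \<bullet> D)"
    using E that unfolding gderiv_def by (rule has_derivative_unique)
  \<comment> \<open>Evaluating both functionals at \<open>E - D\<close> makes the squared norm of
    the difference vanish.\<close>
  then have "(E - D) \<bullet> E = (E - D) \<bullet> D" by (rule fun_cong)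
  then have "(E - D) \<bullet> (E - D) = 0" by (simp add: inner_diff_right)
  then show "E = D" by simp
qed

lemma cont_differentiable_GDERIV_gradient:
  "cont_differentiable f \<Longrightarrow> GDERIV f x :> gradient f x"
  unfolding cont_differentiable_def by (auto dest!: spec[where x = x] simp: gradient_eq)

text \<open>Reduction to one variable: the restriction \<open>?g\<close> of \<open>f\<close> to the
  line through \<open>x\<close> and \<open>y\<close> is convex, so it lies above its tangent at 0,
  whose slope is given by the chain rule.\<close>

lemma convex_on_above_gradient:
  fixes f :: "'a::real_inner \<Rightarrow> real"
  assumes conv: "convex_on UNIV f" and D: "GDERIV f x :> D"
  shows "f x + (y - x) \<bullet> D \<le> f y"
proof -
  let ?g = "\<lambda>t. f (x + t *\<^sub>R (y - x))"
  have "convex_on UNIV ?g"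
  proof (rule convex_onI)
    fix t a b :: real assume t: "0 < t" "t < 1"
    have "x + ((1 - t) *\<^sub>R a + t *\<^sub>R b) *\<^sub>R (y - x)
        = (1 - t) *\<^sub>R (x + a *\<^sub>R (y - x)) + t *\<^sub>R (x + b *\<^sub>R (y - x))"
      by (simp add: algebra_simps)
    then show "?g ((1 - t) *\<^sub>R a + t *\<^sub>R b) \<le> (1 - t) * ?g a + t * ?g b"
      using convex_onD[OF conv, of t] t by simp
  qed simp
  moreover have "(?g has_real_derivative (y - x) \<bullet> D) (at 0 within UNIV)"
  proof -
    \<comment> \<open>The base point keeps the form of the line at parameter 0, so that the chain
      rule applies verbatim.\<close>
    have "(f has_derivative (\<lambda>v. v \<bullet> D)) (at (x + 0 *\<^sub>R (y - x)))"
      using D by (simp add: gderiv_def)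
    moreover have "((\<lambda>t. x + t *\<^sub>R (y - x)) has_derivative (\<lambda>t. t *\<^sub>R (y - x))) (at 0)"
      by (auto intro!: derivative_eq_intros)
    ultimately have "(?g has_derivative (\<lambda>t. (t *\<^sub>R (y - x)) \<bullet> D)) (at 0)"
      by (rule has_derivative_compose[rotated])
    then show ?thesis
      unfolding has_field_derivative_def
      by (rule has_derivative_eq_rhs) (simp add: fun_eq_iff)
  qed
  ultimately have "?g 1 - ?g 0 \<ge> ((y - x) \<bullet> D) * (1 - 0)"
    by (intro convex_on_imp_above_tangent[where A = UNIV]) auto
  then show ?thesis by simp
qed

lemma replace_block_self: "replace_block own i x x = x"
  by (simp add: replace_block_def vec_eq_iff)

lemma replace_block_idem:
  "replace_block own i (replace_block own i y x) x = replace_block own i y x"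
  by (simp add: replace_block_def vec_eq_iff)

text \<open>The displacement is supported on block \<open>i\<close>, where the two gradients have
  the same entries.\<close>

lemma pseudo_gradient_inner_replace_block:
  "(replace_block own i y x - x) \<bullet> gradient (own_objective own J i x) x
   = (replace_block own i y x - x) \<bullet> pseudo_gradient own J x"
  by (auto simp: inner_vec_def replace_block_def pseudo_gradient_def intro!: sum.cong)

text \<open>A unilateral deviation of player \<open>i\<close> is a test point of the variational
  inequality. Convexity in the own block then turns the first-order inequality into
  optimality.\<close>

lemma solves_VI_imp_is_GNE:
  assumes diff: "\<And>i x. cont_differentiable (own_objective own J i x)"
    and conv: "\<And>i x. convex_on UNIV (own_objective own J i x)"
    and VI: "solves_VI X (pseudo_gradient own J) x"
  shows "is_GNE own J X x"
  unfolding is_GNE_def is_arg_min_def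
proof (intro allI conjI notI)
  show "replace_block own i x x \<in> X" for i
    using VI by (simp add: replace_block_self solves_VI_def)
next
  fix i
  let ?f = "own_objective own J i x"
  assume "\<exists>y. replace_block own i y x \<in> X \<and> ?f y < ?f x"
  then obtain y where y: "replace_block own i y x \<in> X" "?f y < ?f x" by blast
  let ?y = "replace_block own i y x"
  have "0 \<le> (?y - x) \<bullet> pseudo_gradient own J x"
    using VI y(1) by (simp add: solves_VI_def)
  then have "?f x \<le> ?f ?y"
    using convex_on_above_gradient[OF conv cont_differentiable_GDERIV_gradient[OF diff], of i x x ?y]
    by (simp add: pseudo_gradient_inner_replace_block)
  \<comment> \<open>The own objective reads only block \<open>i\<close> of its argument.\<close>
  moreover have "?f ?y = ?f y"
    by (simp add: own_objective_def replace_block_idem)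
  ultimately show False using y(2) by simp
qed

section \<open>Minimising a positive definite quadratic function over a closed convex set\<close>

lemma positive_definite_coercive:
  fixes Q :: "'a::euclidean_space \<Rightarrow> 'a"
  assumes lin: "linear Q" and pos: "\<And>v. v \<noteq> 0 \<Longrightarrow> 0 < v \<bullet> Q v"
  obtains c where "0 < c" "\<And>v. c * (norm v)\<^sup>2 \<le> v \<bullet> Q v"
proof -
  have "continuous_on (sphere 0 1) (\<lambda>v. v \<bullet> Q v)"
    by (intro continuous_intros linear_continuous_on linear_conv_bounded_linear[THEN iffD1] lin)
  moreover have "sphere (0::'a) 1 \<noteq> {}" by simp
  ultimately obtain u where u: "u \<in> sphere 0 1" "\<And>v. v \<in> sphere 0 1 \<Longrightarrow> u \<bullet> Q u \<le> v \<bullet> Q v"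
    using continuous_attains_inf[OF compact_sphere, of 0 1 "\<lambda>v. v \<bullet> Q v"] by blast
  show thesis
  proof
    show "0 < u \<bullet> Q u" using u(1) by (intro pos) auto
    fix v :: 'a
    show "(u \<bullet> Q u) * (norm v)\<^sup>2 \<le> v \<bullet> Q v"
    proof (cases "v = 0")
      case False
      then have "u \<bullet> Q u \<le> (v /\<^sub>R norm v) \<bullet> Q (v /\<^sub>R norm v)"
        by (intro u(2)) simp
      also have "\<dots> = (v \<bullet> Q v) / (norm v)\<^sup>2"
        by (simp add: linear_scale[OF lin] power2_eq_square divide_simps)
      finally show ?thesis using False by (simp add: field_simps)
    qed simp
  qed
qed

text \<open>Coercivity confines the search to a compact set: outside a large ball the function is
  nonnegative, while at the origin, a point of \<open>C\<close>, it is 0.\<close>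

lemma quadratic_attains_min:
  fixes Q :: "'a::euclidean_space \<Rightarrow> 'a"
  assumes lin: "linear Q" and pos: "\<And>v. v \<noteq> 0 \<Longrightarrow> 0 < v \<bullet> Q v"
    and C: "closed C" "0 \<in> C"
  shows "\<exists>v\<in>C. \<forall>w\<in>C. 1/2 * (v \<bullet> Q v) + v \<bullet> b \<le> 1/2 * (w \<bullet> Q w) + w \<bullet> b"
proof -
  let ?f = "\<lambda>v. 1/2 * (v \<bullet> Q v) + v \<bullet> b"
  obtain c where c: "0 < c" "\<And>v. c * (norm v)\<^sup>2 \<le> v \<bullet> Q v"
    using positive_definite_coercive[OF lin pos] by blast
  \<comment> \<open>Beyond this radius the quadratic part, at least c/2 times the squared norm of w,
    dominates the bound |w| |b| on the linear part.\<close>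
  define R where "R = 2 * norm b / c"
  have "R \<ge> 0" using c(1) by (simp add: R_def)
  have "continuous_on (C \<inter> cball 0 R) ?f"
    by (intro continuous_intros linear_continuous_on linear_conv_bounded_linear[THEN iffD1] lin)
  moreover have "compact (C \<inter> cball 0 R)" using C(1) by (simp add: closed_Int_compact)
  moreover have "0 \<in> C \<inter> cball 0 R" using C(2) \<open>R \<ge> 0\<close> by simp
  ultimately obtain v where v: "v \<in> C \<inter> cball 0 R" "\<And>w. w \<in> C \<inter> cball 0 R \<Longrightarrow> ?f v \<le> ?f w"
    using continuous_attains_inf[of "C \<inter> cball 0 R" ?f] by blast
  have "?f v \<le> ?f w" if "w \<in> C" for w
  proof (cases "norm w \<le> R")
    case False
    then have "2 * norm b \<le> c * norm w"
      using c(1) by (simp add: R_def field_simps)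
    then have "2 * norm b * norm w \<le> c * norm w * norm w"
      by (intro mult_right_mono) auto
    moreover have "- (norm w * norm b) \<le> w \<bullet> b"
      using Cauchy_Schwarz_ineq2[of w b] by linarith
    ultimately have "0 \<le> ?f w"
      using c(2)[of w] by (simp add: power2_eq_square algebra_simps)
    moreover have "?f v \<le> 0"
      using v(2)[OF \<open>0 \<in> C \<inter> cball 0 R\<close>] by simp
    ultimately show ?thesis by linarith
  qed (use v that in auto)
  then show ?thesis using v(1) by blast
qed

text \<open>First-order optimality along the segment from \<open>v\<close> to \<open>w\<close>: the
  increment of the function is t times the directional derivative plus a term of order t^2.\<close>

lemma quadratic_min_directional:
  fixes Q :: "'a::real_inner \<Rightarrow> 'a"
  assumes lin: "linear Q" and sym: "\<And>u v. u \<bullet> Q v = v \<bullet> Q u"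
    and C: "convex C" "v \<in> C" "w \<in> C"
    and min: "\<And>w. w \<in> C \<Longrightarrow> 1/2 * (v \<bullet> Q v) + v \<bullet> b \<le> 1/2 * (w \<bullet> Q w) + w \<bullet> b"
  shows "0 \<le> (w - v) \<bullet> (Q v + b)"
proof -
  let ?d = "w - v"
  have "0 \<le> ?d \<bullet> (Q v + b) + t * (1/2 * (?d \<bullet> Q ?d))" if t: "0 < t" "t < 1" for t
  proof -
    have "v + t *\<^sub>R ?d = (1 - t) *\<^sub>R v + t *\<^sub>R w" by (simp add: algebra_simps)
    then have "v + t *\<^sub>R ?d \<in> C" using C t by (simp add: convexD)
    from min[OF this] have "0 \<le> t * (?d \<bullet> (Q v + b) + t * (1/2 * (?d \<bullet> Q ?d)))"
      using sym[of v ?d]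
      by (simp add: linear_add[OF lin] linear_scale[OF lin] inner_add_left inner_add_right
          distrib_left)
    then show ?thesis using t(1) by (simp add: zero_le_mult_iff)
  qed
  \<comment> \<open>Having divided by t, let t tend to 0 from the right.\<close>
  then have "eventually (\<lambda>t. 0 \<le> ?d \<bullet> (Q v + b) + t * (1/2 * (?d \<bullet> Q ?d))) (at_right 0)"
    by (auto simp: eventually_at_right[of 0 1] intro: exI[of _ 1])
  moreover have "((\<lambda>t. ?d \<bullet> (Q v + b) + t * (1/2 * (?d \<bullet> Q ?d)))
      \<longlongrightarrow> ?d \<bullet> (Q v + b) + 0 * (1/2 * (?d \<bullet> Q ?d))) (at_right 0)"
    by (intro tendsto_intros)
  ultimately have "0 \<le> ?d \<bullet> (Q v + b) + 0 * (1/2 * (?d \<bullet> Q ?d))"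
    by (intro tendsto_lowerbound) auto
  then show ?thesis by simp
qed

lemma orthant_complementarity:
  fixes v g :: "real ^ 'a"
  assumes "0 \<le> v" and VI: "\<And>w. 0 \<le> w \<Longrightarrow> 0 \<le> (w - v) \<bullet> g"
  shows "0 \<le> g" "v \<bullet> g = 0"
proof -
  have "0 \<le> (v + axis r 1 - v) \<bullet> g" for r
    using \<open>0 \<le> v\<close> by (intro VI) (auto simp: less_eq_vec_def axis_def)
  then show "0 \<le> g" by (simp add: less_eq_vec_def inner_axis')
  \<comment> \<open>Moving along the ray through \<open>v\<close> in both directions yields both
    signs of the inner product.\<close>
  have "0 \<le> (2 *\<^sub>R v - v) \<bullet> g" "0 \<le> (0 - v) \<bullet> g"
    using \<open>0 \<le> v\<close> by (intro VI; simp add: less_eq_vec_def)+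
  then show "v \<bullet> g = 0" by (simp add: scaleR_2)
qed

section \<open>The Laplacian, consensus vectors and stacked constraints\<close>

lemma sum_UNIV_prod:
  fixes f :: "'a::finite \<times> 'b::finite \<Rightarrow> 'c::comm_monoid_add"
  shows "(\<Sum>r\<in>UNIV. f r) = (\<Sum>i\<in>UNIV. \<Sum>j\<in>UNIV. f (i, j))"
proof -
  have "(\<Sum>r\<in>UNIV. f r) = (\<Sum>(i, j)\<in>UNIV \<times> UNIV. f (i, j))"
    by (simp add: case_prod_unfold)
  then show ?thesis by (simp only: sum.cartesian_product)
qed

text \<open>The Dirichlet form of the graph, obtained by summation by parts. Symmetry, nonnegativity
  and the consensus kernel of \<open>laplacian_kron A\<close> are all read off from it.\<close>

lemma inner_laplacian_kron:
  fixes u v :: "real ^ ('p::finite \<times> 'm::finite)"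
  assumes "is_adjacency A"
  shows "u \<bullet> (laplacian_kron A *v v)
    = 1/2 * (\<Sum>i\<in>UNIV. \<Sum>k\<in>UNIV. \<Sum>j\<in>UNIV. A $ i $ k * ((u $ (i, j) - u $ (k, j)) * (v $ (i, j) - v $ (k, j))))"
proof -
  have sym: "A $ i $ k = A $ k $ i" for i k
  proof -
    have "A $ i $ k = transpose A $ i $ k" using assms by (simp add: is_adjacency_def)
    then show ?thesis by (simp add: transpose_def)
  qed
  have entry: "(laplacian_kron A *v v) $ (i, j) = (\<Sum>k\<in>UNIV. A $ i $ k * (v $ (i, j) - v $ (k, j)))" for i j
  proof -
    have "(laplacian_kron A *v v) $ (i, j)
        = (\<Sum>k\<in>UNIV. \<Sum>l\<in>UNIV. laplacian A $ i $ k * (if j = l then 1 else 0) * v $ (k, l))"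
      by (simp add: matrix_vector_mult_def laplacian_kron_def kron_mat_def mat_def
          sum_UNIV_prod)
    also have "\<dots> = (\<Sum>k\<in>UNIV. laplacian A $ i $ k * v $ (k, j))"
    proof (intro sum.cong refl)
      fix k
      have "(\<Sum>l\<in>UNIV. laplacian A $ i $ k * (if j = l then 1 else 0) * v $ (k, l))
          = (\<Sum>l\<in>UNIV. if j = l then laplacian A $ i $ k * v $ (k, l) else 0)"
        by (intro sum.cong) auto
      then show "(\<Sum>l\<in>UNIV. laplacian A $ i $ k * (if j = l then 1 else 0) * v $ (k, l))
          = laplacian A $ i $ k * v $ (k, j)"
        by simp
    qed
    also have "\<dots> = (\<Sum>k\<in>UNIV. (if i = k then (\<Sum>l\<in>UNIV. A $ i $ l) * v $ (i, j) else 0) - A $ i $ k * v $ (k, j))"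
      by (intro sum.cong) (auto simp: laplacian_def matrix_vector_mult_def algebra_simps)
    also have "\<dots> = (\<Sum>k\<in>UNIV. A $ i $ k * (v $ (i, j) - v $ (k, j)))"
      by (simp add: sum_subtractf right_diff_distrib sum_distrib_right)
    finally show ?thesis .
  qed
  let ?S = "\<Sum>i\<in>UNIV. \<Sum>k\<in>UNIV. \<Sum>j\<in>UNIV. A $ i $ k * (u $ (i, j) * (v $ (i, j) - v $ (k, j)))"
  let ?T = "\<Sum>i\<in>UNIV. \<Sum>k\<in>UNIV. \<Sum>j\<in>UNIV. A $ i $ k * (u $ (k, j) * (v $ (k, j) - v $ (i, j)))"
  have "u \<bullet> (laplacian_kron A *v v) = (\<Sum>i\<in>UNIV. \<Sum>j\<in>UNIV. u $ (i, j) * (laplacian_kron A *v v) $ (i, j))"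
    by (simp add: inner_vec_def sum_UNIV_prod)
  also have "\<dots> = (\<Sum>i\<in>UNIV. \<Sum>j\<in>UNIV. \<Sum>k\<in>UNIV. A $ i $ k * (u $ (i, j) * (v $ (i, j) - v $ (k, j))))"
    by (simp add: entry sum_distrib_left mult.left_commute)
  also have "\<dots> = ?S"
    by (rule sum.cong[OF refl], rule sum.swap)
  finally have S: "u \<bullet> (laplacian_kron A *v v) = ?S" .
  \<comment> \<open>Swapping the endpoints of each edge uses the symmetry of \<open>A\<close>;
    averaging the two forms gives the factor 1/2.\<close>
  have "?S = (\<Sum>k\<in>UNIV. \<Sum>i\<in>UNIV. \<Sum>j\<in>UNIV. A $ i $ k * (u $ (i, j) * (v $ (i, j) - v $ (k, j))))"
    by (rule sum.swap)
  also have "\<dots> = ?T"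
    by (intro sum.cong refl arg_cong2[where f = "(*)"] sym)
  finally have "?S = ?T" .
  moreover have "?S + ?T = (\<Sum>i\<in>UNIV. \<Sum>k\<in>UNIV. \<Sum>j\<in>UNIV. A $ i $ k * ((u $ (i, j) - u $ (k, j)) * (v $ (i, j) - v $ (k, j))))"
    unfolding sum.distrib[symmetric]
    by (intro sum.cong refl) (simp add: left_diff_distrib right_diff_distrib)
  ultimately show ?thesis using S by linarith
qed

lemma laplacian_kron_sym:
  "is_adjacency A \<Longrightarrow> u \<bullet> (laplacian_kron A *v v) = v \<bullet> (laplacian_kron A *v u)"
  by (simp add: inner_laplacian_kron mult.commute)

lemma laplacian_kron_nonneg:
  "is_adjacency A \<Longrightarrow> 0 \<le> v \<bullet> (laplacian_kron A *v v)"
  by (simp add: inner_laplacian_kron) (intro sum_nonneg, simp add: is_adjacency_def)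

lemma inner_kron_vec_one_laplacian_kron:
  "is_adjacency A \<Longrightarrow> kron_vec 1 w \<bullet> (laplacian_kron A *v z) = 0"
  by (simp add: inner_laplacian_kron kron_vec_def)

text \<open>The Dirichlet form is a sum of nonnegative terms, so each vanishes. Hence
  \<open>v\<close> agrees across every edge, and by connectedness along paths between any two
  players.\<close>

lemma laplacian_kron_null_consensus:
  fixes v :: "real ^ ('p::finite \<times> 'm::finite)"
  assumes A: "is_adjacency A" "graph_connected A"
    and null: "v \<bullet> (laplacian_kron A *v v) = 0"
  shows "\<exists>l. v = kron_vec 1 l"
proof -
  have nn: "0 \<le> A $ i $ k * ((v $ (i, j) - v $ (k, j)) * (v $ (i, j) - v $ (k, j)))" for i k j
    using A(1) by (simp add: is_adjacency_def)
  have edge: "v $ (i, j) = v $ (k, j)" if "(i, k) \<in> graph_edges A" for i k j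
  proof -
    have "A $ i $ k * ((v $ (i, j) - v $ (k, j)) * (v $ (i, j) - v $ (k, j))) = 0"
      using null by (simp add: inner_laplacian_kron[OF A(1)] sum_nonneg_eq_0_iff sum_nonneg nn) blast
    then show ?thesis using that by (auto simp: graph_edges_def)
  qed
  have const: "v $ (i, j) = v $ (k, j)" for i k j
  proof -
    have "(i, k) \<in> (graph_edges A)\<^sup>*" using A(2) by (simp add: graph_connected_def)
    then show ?thesis by induction (use edge in auto)
  qed
  \<comment> \<open>Here \<open>undefined\<close> is just some player; by \<open>const\<close> the
    choice is immaterial.\<close>
  have "v = kron_vec 1 (\<chi> j. v $ (undefined, j))"
    using const by (auto simp: vec_eq_iff kron_vec_def)
  then show ?thesis by blast
qed

text \<open>Coordinate \<open>k\<close> has the single owner \<open>own k\<close>, so only that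
  player's copy of \<open>l\<close> contributes to entry \<open>k\<close>.\<close>

lemma transpose_block_diag_kron_vec_one:
  "transpose (block_diag own G) *v kron_vec 1 l = transpose G *v l"
proof -
  have "(\<Sum>r\<in>UNIV. (if own k = fst r then G $ snd r $ k else 0) * l $ snd r)
      = (\<Sum>j\<in>UNIV. G $ j $ k * l $ j)" for k
  proof -
    have "(\<Sum>r\<in>UNIV. (if own k = fst r then G $ snd r $ k else 0) * l $ snd r)
        = (\<Sum>i\<in>UNIV. \<Sum>j\<in>UNIV. if own k = i then G $ j $ k * l $ j else 0)"
      by (simp add: sum_UNIV_prod) (intro sum.cong, auto)
    also have "\<dots> = (\<Sum>j\<in>UNIV. \<Sum>i\<in>UNIV. if own k = i then G $ j $ k * l $ j else 0)"
      by (rule sum.swap)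
    also have "\<dots> = (\<Sum>j\<in>UNIV. G $ j $ k * l $ j)"
      by simp
    finally show ?thesis .
  qed
  then show ?thesis
    by (simp add: vec_eq_iff matrix_vector_mult_def transpose_def block_diag_def kron_vec_def)
qed

lemma inner_kron_vec_one_stack: "kron_vec 1 l \<bullet> stack h = l \<bullet> (\<Sum>i\<in>UNIV. h i)"
proof -
  have "kron_vec 1 l \<bullet> stack h = (\<Sum>i\<in>UNIV. \<Sum>j\<in>UNIV. l $ j * h i $ j)"
    by (simp add: inner_vec_def kron_vec_def stack_def sum_UNIV_prod)
  also have "\<dots> = (\<Sum>i\<in>UNIV. l \<bullet> h i)" by (simp add: inner_vec_def)
  finally show ?thesis by (simp add: inner_sum_right)
qed

lemma inner_kron_vec_one_kron_vec_one:
  fixes l w :: "real ^ 'm::finite"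
  shows "(kron_vec 1 l :: real ^ ('p::finite \<times> 'm)) \<bullet> kron_vec 1 w = real CARD('p) * (l \<bullet> w)"
proof -
  have "(kron_vec 1 l :: real ^ ('p \<times> 'm)) \<bullet> kron_vec 1 w
      = (\<Sum>i\<in>(UNIV :: 'p set). \<Sum>j\<in>UNIV. l $ j * w $ j)"
    by (simp add: inner_vec_def kron_vec_def sum_UNIV_prod)
  then show ?thesis by (simp add: inner_vec_def)
qed

text \<open>Consensus vectors are orthogonal to the range of the Laplacian, and pairing with them
  adds the local constraint data up to the shared constraint.\<close>

lemma inner_kron_vec_one_constraint:
  assumes "is_adjacency A"
  shows "kron_vec 1 l \<bullet> (laplacian_kron A *v z - \<alpha> *\<^sub>R (block_diag own G *v x - stack h))
    = - (\<alpha> * (l \<bullet> (G *v x - (\<Sum>i\<in>UNIV. h i))))"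
proof -
  have "kron_vec 1 l \<bullet> (block_diag own G *v x) = l \<bullet> (G *v x)"
    by (metis dot_lmul_matrix transpose_block_diag_kron_vec_one transpose_matrix_vector)
  then show ?thesis
    by (simp add: inner_diff_right inner_kron_vec_one_laplacian_kron[OF assms]
        inner_kron_vec_one_stack)
qed

section \<open>The dual problem and its optimality conditions\<close>

definition dual_hessian where
  "dual_hessian own G A l
   = block_diag own G *v (transpose (block_diag own G) *v l) + laplacian_kron A *v l"

lemma linear_dual_hessian: "linear (dual_hessian own G A)"
  unfolding dual_hessian_def
  by (intro linearI) (simp_all add: matrix_vector_right_distrib matrix_vector_mult_scaleR scaleR_right_distrib)

lemma inner_dual_hessian:
  "u \<bullet> dual_hessian own G A v
   = (transpose (block_diag own G) *v u) \<bullet> (transpose (block_diag own G) *v v)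
     + u \<bullet> (laplacian_kron A *v v)"
  by (simp add: dual_hessian_def inner_add_right) (metis dot_lmul_matrix transpose_matrix_vector)

lemma dual_hessian_sym:
  "is_adjacency A \<Longrightarrow> u \<bullet> dual_hessian own G A v = v \<bullet> dual_hessian own G A u"
  by (simp add: inner_dual_hessian laplacian_kron_sym[of A u v] inner_commute)

lemma dual_hessian_pos:
  assumes rank: "rank (G :: real ^ 'n::finite ^ 'm::finite) = CARD('m)"
    and A: "is_adjacency A" "graph_connected A" and "v \<noteq> 0"
  shows "0 < v \<bullet> dual_hessian own G A v"
proof (rule ccontr)
  let ?B = "transpose (block_diag own G) *v v"
  assume "\<not> ?thesis"
  \<comment> \<open>Both summands of the quadratic form are nonnegative, so a nonpositive total
    forces each to be 0.\<close>
  then have zero: "?B \<bullet> ?B = 0" "v \<bullet> (laplacian_kron A *v v) = 0"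
    using inner_ge_zero[of ?B] laplacian_kron_nonneg[OF A(1), of v]
    unfolding inner_dual_hessian by linarith+
  from laplacian_kron_null_consensus[OF A zero(2)] obtain l where l: "v = kron_vec 1 l" by blast
  from zero(1) have "transpose G *v l = 0"
    unfolding l transpose_block_diag_kron_vec_one by (rule inner_eq_zero_iff[THEN iffD1])
  moreover have "inj ((*v) (transpose G))"
    using rank by (simp add: full_rank_injective[symmetric] rank_transpose)
  ultimately have "l = 0" by (metis injD matrix_vector_mult_0_right)
  with l have "v = 0" by (simp add: kron_vec_def vec_eq_iff)
  with \<open>v \<noteq> 0\<close> show False ..
qed

lemma dual_objective_eq:
  "dual_objective own J G h A \<alpha> x z l
   = 1/2 * (l \<bullet> dual_hessian own G A l)
     + l \<bullet> (block_diag own G *v pseudo_gradient own J x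
            - \<alpha> *\<^sub>R (block_diag own G *v x - stack h) + laplacian_kron A *v z)"
  by (simp add: dual_objective_def inner_dual_hessian power2_norm_eq_inner distrib_left)

lemma dual_map_complementarity:
  fixes own :: "'n::finite \<Rightarrow> 'p::finite" and J :: "'p \<Rightarrow> real ^ 'n \<Rightarrow> real"
    and G :: "real ^ 'n ^ 'm::finite" and h :: "'p \<Rightarrow> real ^ 'm" and A :: "real ^ 'p ^ 'p"
    and \<alpha> :: real and x :: "real ^ 'n" and z :: "real ^ ('p \<times> 'm)"
  assumes rank: "rank G = CARD('m)" and A: "is_adjacency A" "graph_connected A"
  defines "l \<equiv> dual_map own J G h A \<alpha> x z"
  defines "g \<equiv> dual_hessian own G A l + (block_diag own G *v pseudo_gradient own J x
            - \<alpha> *\<^sub>R (block_diag own G *v x - stack h) + laplacian_kron A *v z)"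
  shows "0 \<le> l" "0 \<le> g" "l \<bullet> g = 0"
proof -
  let ?C = "{l :: real ^ ('p \<times> 'm). 0 \<le> l}"
  have orthant: "?C = (\<Inter>r. {l. 0 \<le> l $ r})" by (auto simp: less_eq_vec_def)
  have closed: "closed ?C"
    unfolding orthant by (intro closed_INT ballI closed_Collect_le continuous_intros)
  have convex: "convex ?C"
    by (auto simp: convex_def less_eq_vec_def)
  let ?f = "dual_objective own J G h A \<alpha> x z"
  have "\<exists>v\<in>?C. \<forall>w\<in>?C. ?f v \<le> ?f w"
    unfolding dual_objective_eq
    by (intro quadratic_attains_min linear_dual_hessian dual_hessian_pos rank A closed) simp_all
  then obtain v where "is_arg_min ?f (\<lambda>l. 0 \<le> l) v"
    by (auto simp: is_arg_min_def not_less)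
  \<comment> \<open>\<open>arg_min\<close> is a choice operator, so \<open>l\<close> is known to be
    a minimiser only once some minimiser exists.\<close>
  then have "is_arg_min ?f (\<lambda>l. 0 \<le> l) l"
    unfolding l_def dual_map_def arg_min_def by (rule someI)
  then have min: "0 \<le> l" "\<And>w. 0 \<le> w \<Longrightarrow> ?f l \<le> ?f w"
    by (auto simp: is_arg_min_def not_less)
  show "0 \<le> l" by fact
  have "0 \<le> (w - l) \<bullet> g" if "0 \<le> w" for w
    unfolding g_def
    by (rule quadratic_min_directional[where C = ?C, OF linear_dual_hessian dual_hessian_sym[OF A(1)] convex])
      (use min that in \<open>auto simp: dual_objective_eq\<close>)
  from orthant_complementarity[OF \<open>0 \<le> l\<close> this] show "0 \<le> g" "l \<bullet> g = 0" by blast+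
qed

section \<open>From an equilibrium to the KKT conditions and the v-GNE property\<close>

theorem lemma3p6:
  fixes own :: "'n::finite \<Rightarrow> 'p::finite"
    and J :: "'p \<Rightarrow> real ^ 'n \<Rightarrow> real"
    and G :: "real ^ 'n ^ 'm::finite"
    and h :: "'p \<Rightarrow> real ^ 'm"
    and A :: "real ^ 'p ^ 'p"
    and \<alpha> :: real
    and xbar :: "real ^ 'n"
    and zbar lbar :: "real ^ ('p \<times> 'm)"
  assumes "\<And>i x. cont_differentiable (own_objective own J i x)"
    and "\<And>i x. convex_on UNIV (own_objective own J i x)"
    and "slater G h"
    and "rank G = CARD('m)"
    and "is_adjacency A"
    and "graph_connected A"
    and "\<alpha> > 0"
    and "is_equilibrium (dynamics own J G h A \<alpha>) (xbar, zbar)"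
    and "lbar = dual_map own J G h A \<alpha> xbar zbar"
  shows "pseudo_gradient own J xbar + transpose (block_diag own G) *v lbar = 0
    \<and> lbar \<bullet> kron_vec 1 (G *v xbar - (\<Sum>i\<in>UNIV. h i)) = 0
    \<and> G *v xbar - (\<Sum>i\<in>UNIV. h i) \<le> 0
    \<and> 0 \<le> lbar
    \<and> (\<exists>l. 0 \<le> l \<and> lbar = kron_vec 1 l)
    \<and> is_vGNE own J (feasible_set G h) xbar"
proof -
  let ?F = "pseudo_gradient own J xbar"
  let ?B = "block_diag own G"
  let ?r = "G *v xbar - (\<Sum>i\<in>UNIV. h i)"
  have eq: "- ?F - transpose ?B *v lbar = 0" "laplacian_kron A *v lbar = 0"
    using assms(8) by (auto simp: is_equilibrium_def dynamics_def Let_def assms(9) zero_prod_def)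
  have F: "?F = - (transpose ?B *v lbar)"
    using eq(1) by (metis add.inverse_inverse eq_iff_diff_eq_0)
  let ?w = "laplacian_kron A *v zbar - \<alpha> *\<^sub>R (?B *v xbar - stack h)"
  \<comment> \<open>Stationarity cancels the \<open>block_diag\<close> part of the Hessian term, and
    \<open>eq(2)\<close> removes the Laplacian part.\<close>
  have "?B *v ?F = - (?B *v (transpose ?B *v lbar))"
    by (simp add: F linear_neg)
  then have w: "dual_hessian own G A lbar + (?B *v ?F - \<alpha> *\<^sub>R (?B *v xbar - stack h)
      + laplacian_kron A *v zbar) = ?w"
    by (simp add: dual_hessian_def eq(2))
  have l0: "0 \<le> lbar" and w0: "0 \<le> ?w" and lw: "lbar \<bullet> ?w = 0"
    using dual_map_complementarity[OF assms(4-6), where own = own and J = J and h = h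
        and \<alpha> = \<alpha> and x = xbar and z = zbar]
    unfolding assms(9)[symmetric] w by blast+
  obtain l where l: "lbar = kron_vec 1 l"
    using laplacian_kron_null_consensus[OF assms(5,6), of lbar] eq(2) by auto
  have l_nonneg: "0 \<le> l"
    using l0 by (auto simp: l less_eq_vec_def kron_vec_def)
  \<comment> \<open>As \<open>lbar\<close> is itself a consensus vector, \<open>lw\<close> says that
    \<alpha> times this product is 0.\<close>
  have lr: "l \<bullet> ?r = 0"
    using lw inner_kron_vec_one_constraint[OF assms(5), where l = l and z = zbar and \<alpha> = \<alpha>
        and own = own and G = G and x = xbar and h = h] \<open>\<alpha> > 0\<close> by (simp add: l)
  have r: "?r \<le> 0"
  proof -
    have "?r $ j \<le> 0" for j
    proof -
      \<comment> \<open>This nonnegative consensus vector isolates row \<open>j\<close> of the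
        shared constraint.\<close>
      have "0 \<le> (kron_vec 1 (axis j 1) :: real ^ ('p \<times> 'm)) \<bullet> ?w"
        using w0 unfolding inner_vec_def less_eq_vec_def
        by (intro sum_nonneg) (auto simp: kron_vec_def axis_def)
      then have "\<alpha> * (axis j 1 \<bullet> ?r) \<le> 0"
        unfolding inner_kron_vec_one_constraint[OF assms(5)] by simp
      then show ?thesis using \<open>\<alpha> > 0\<close> by (simp add: inner_axis' mult_le_0_iff)
    qed
    then show ?thesis by (simp add: less_eq_vec_def)
  qed
  have "solves_VI (feasible_set G h) (pseudo_gradient own J) xbar"
    unfolding solves_VI_def
  proof (intro conjI ballI)
    show "xbar \<in> feasible_set G h" using r by (simp add: feasible_set_def)
    fix y assume y: "y \<in> feasible_set G h"
    \<comment> \<open>Stationarity trades \<open>?F\<close> for the multiplier \<open>l\<close>;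
      then \<open>lr\<close> removes the residual at \<open>xbar\<close>, and feasibility of
      \<open>y\<close> with nonnegative \<open>l\<close> fixes the sign.\<close>
    have "(y - xbar) \<bullet> ?F = - (l \<bullet> (G *v (y - xbar)))"
      unfolding F l transpose_block_diag_kron_vec_one
      by (simp add: inner_commute[of "y - xbar"] dot_lmul_matrix)
    also have "G *v (y - xbar) = (G *v y - (\<Sum>i\<in>UNIV. h i)) - ?r"
      by (simp add: matrix_vector_mult_diff_distrib)
    also have "- (l \<bullet> \<dots>) = - (l \<bullet> (G *v y - (\<Sum>i\<in>UNIV. h i)))"
      by (simp only: inner_diff_right[of l _ ?r] lr)
    also have "\<dots> \<ge> 0"
      using y l_nonneg unfolding feasible_set_def inner_vec_def less_eq_vec_def
      by (auto intro!: sum_nonpos mult_nonneg_nonpos)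
    finally show "0 \<le> (y - xbar) \<bullet> ?F" .
  qed
  then have "is_vGNE own J (feasible_set G h) xbar"
    unfolding is_vGNE_def using solves_VI_imp_is_GNE assms(1,2) by blast
  moreover have "lbar \<bullet> kron_vec 1 ?r = 0"
    by (simp only: l inner_kron_vec_one_kron_vec_one lr)
  ultimately show ?thesis
    using eq(1) r l0 l l_nonneg F by auto
qed

end
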